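(* Let $H$ be a complex Hilbert space, let $R_0\in B(H)_+$ be trace-class, and let $(u_n)_{n\ge 0}\subset H$ be a sequence of unit vectors. Define $R_{n+1}=R_n^{1/2}(I-|u_n\rangle\langle u_n|)R_n^{1/2}$ and $E_n=R_n^{1/2}u_n$ for $n\ge 0$, and let $R_\infty$ be the strong operator limit of $(R_n)$. Then each $R_n$ and $R_\infty$ is trace-class and $$\operatorname{tr}(R_0-R_\infty)=\sum_{n=0}^\infty\|E_n\|^2,$$ with absolute convergence of the series on the right. In particular, $\sum_{n=0}^\infty\|E_n\|^2\le\operatorname{tr}(R_0)<\infty$.
   Context: $B(H)_+$ is the set of bounded positive operators on $H$. Inner products are linear in the second variable. $|a\rangle\langle b|$ denotes the operator $x\mapsto\langle b,x\rangle a$. Each $R_n$ is in $B(H)_+$, and the sequence $(R_n)$ is decreasing in the Löwner order and bounded below by $0$, so it converges in the strong operator topology to some $R_\infty\in B(H)_+$ (if some $R_n=0$, then $R_k=0$ for all $k\ge n$). *)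

theory Defs
  imports "HOL-Analysis.Analysis" "HOL-Library.Complex_Order"
begin

text \<open>
  A complex inner product space also carries its underlying real inner product
  space structure, so that the metric and topological library applies. The axioms tie the real
  structure to the complex one: real scalars act through \<open>scaleC\<close>, and the real inner
  product is the real part of \<open>cinner\<close>. Definiteness of \<open>cinner\<close> and
  \<open>norm x = sqrt (Re (cinner x x))\<close> thus come from \<open>real_inner\<close>.
  The complex inner product is linear in the second variable.
\<close>

class complex_inner = real_inner +
  fixes scaleC :: "complex \<Rightarrow> 'a \<Rightarrow> 'a" (infixr \<open>*\<^sub>C\<close> 75)
    and cinner :: "'a \<Rightarrow> 'a \<Rightarrow> complex"
  assumes scaleC_add_right: "a *\<^sub>C (x + y) = a *\<^sub>C x + a *\<^sub>C y"
    and scaleC_add_left: "(a + b) *\<^sub>C x = a *\<^sub>C x + b *\<^sub>C x"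
    and scaleC_scaleC: "a *\<^sub>C b *\<^sub>C x = (a * b) *\<^sub>C x"
    and scaleR_scaleC: "scaleR r x = complex_of_real r *\<^sub>C x"
    and cinner_commute: "cinner x y = cnj (cinner y x)"
    and cinner_add_right: "cinner x (y + z) = cinner x y + cinner x z"
    and cinner_scaleC_right: "cinner x (a *\<^sub>C y) = a * cinner x y"
    and inner_eq_Re_cinner: "inner x y = Re (cinner x y)"

class complex_hilbert_space = complex_inner + complete_space

subclass (in complex_hilbert_space) banach ..

instantiation complex :: complex_hilbert_space
begin

definition scaleC_complex :: "complex \<Rightarrow> complex \<Rightarrow> complex"
  where "scaleC_complex a x = a * x"

definition cinner_complex :: "complex \<Rightarrow> complex \<Rightarrow> complex"
  where "cinner_complex x y = cnj x * y"

instance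
  by standard
    (auto simp: scaleC_complex_def cinner_complex_def algebra_simps scaleR_conv_of_real
      inner_complex_def)

end

lemma cinner_self: "cinner x x = complex_of_real ((norm x)\<^sup>2)"
  for x :: "'a::complex_inner"
proof -
  have "Im (cinner x x) = 0"
    using arg_cong[OF cinner_commute[of x x], of Im] by simp
  moreover have "Re (cinner x x) = (norm x)\<^sup>2"
    by (simp add: inner_eq_Re_cinner[symmetric] power2_norm_eq_inner)
  ultimately show ?thesis
    by (simp add: complex_eq_iff)
qed

text \<open>Operators on \<open>H\<close> are functions \<open>'a \<Rightarrow> 'a\<close> with the predicate below; differences are
  pointwise (\<open>fun_diff_def\<close>), and products are compositions.\<close>

definition bounded_clinear :: "('a::complex_inner \<Rightarrow> 'a) \<Rightarrow> bool" where
  "bounded_clinear A \<longleftrightarrow> bounded_linear A \<and> (\<forall>c x. A (c *\<^sub>C x) = c *\<^sub>C A x)"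

text \<open>The order on \<open>complex\<close> is that of \<open>Complex_Order\<close>: \<open>0 \<le> z\<close> says that
  \<open>z\<close> is real and nonnegative.\<close>

definition positive_op :: "('a::complex_inner \<Rightarrow> 'a) \<Rightarrow> bool" where
  "positive_op A \<longleftrightarrow> bounded_clinear A \<and> (\<forall>x. 0 \<le> cinner x (A x))"

definition rank_one :: "'a::complex_inner \<Rightarrow> 'a \<Rightarrow> 'a \<Rightarrow> 'a" where
  "rank_one a b = (\<lambda>x. cinner b x *\<^sub>C a)"

definition adj :: "('a::complex_hilbert_space \<Rightarrow> 'a) \<Rightarrow> 'a \<Rightarrow> 'a" where
  "adj A = (THE B. bounded_clinear B \<and> (\<forall>x y. cinner x (A y) = cinner (B x) y))"

definition sqrt_op :: "('a::complex_hilbert_space \<Rightarrow> 'a) \<Rightarrow> 'a \<Rightarrow> 'a" where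
  "sqrt_op A = (THE B. positive_op B \<and> B \<circ> B = A)"

definition abs_op :: "('a::complex_hilbert_space \<Rightarrow> 'a) \<Rightarrow> 'a \<Rightarrow> 'a" where
  "abs_op A = sqrt_op (adj A \<circ> A)"

definition sot_tendsto :: "(nat \<Rightarrow> 'a::complex_hilbert_space \<Rightarrow> 'a) \<Rightarrow> ('a \<Rightarrow> 'a) \<Rightarrow> bool" where
  "sot_tendsto A T \<longleftrightarrow> bounded_clinear T \<and> (\<forall>x. (\<lambda>n. A n x) \<longlonglongrightarrow> T x)"

definition sot_lim :: "(nat \<Rightarrow> 'a::complex_hilbert_space \<Rightarrow> 'a) \<Rightarrow> 'a \<Rightarrow> 'a" where
  "sot_lim A = (THE T. sot_tendsto A T)"

definition is_onb :: "'a::complex_hilbert_space set \<Rightarrow> bool" where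
  "is_onb B \<longleftrightarrow>
     (\<forall>e\<in>B. norm e = 1) \<and> (\<forall>e\<in>B. \<forall>f\<in>B. e \<noteq> f \<longrightarrow> cinner e f = 0) \<and>
     closure {\<Sum>e\<in>F. c e *\<^sub>C e | F c. finite F \<and> F \<subseteq> B} = UNIV"

text \<open>Whether \<open>tr \<bar>A\<bar>\<close> is finite, and the value of the trace of a trace-class operator,
  do not depend on the orthonormal basis.\<close>

definition trace_class :: "('a::complex_hilbert_space \<Rightarrow> 'a) \<Rightarrow> bool" where
  "trace_class A \<longleftrightarrow>
     bounded_clinear A \<and> (\<exists>B. is_onb B \<and> (\<lambda>e. cinner e (abs_op A e)) summable_on B)"

definition op_trace :: "('a::complex_hilbert_space \<Rightarrow> 'a) \<Rightarrow> complex" where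
  "op_trace A = (\<Sum>\<^sub>\<infinity>e\<in>(SOME B. is_onb B). cinner e (A e))"

end

theory Submission
  imports Defs
begin

text \<open>
  Each step of the recursion subtracts a rank-one operator, \<open>R\<^bsub>n+1\<^esub> = R\<^sub>n - \<bar>E\<^sub>n\<rangle>\<langle>E\<^sub>n\<bar>\<close>
  (\<open>sqrt_op_sandwich\<close>), and keeps positivity (\<open>positive_op_sqrt_op_sandwich\<close>). Hence
  \<open>R\<^sub>n = R\<^sub>0 - (\<Sum>k<n. \<bar>E\<^sub>k\<rangle>\<langle>E\<^sub>k\<bar>) \<ge> 0\<close>. Evaluating this on an orthonormal basis gives
  \<open>(\<Sum>k<n. \<parallel>E\<^sub>k\<parallel>\<^sup>2) \<le> tr R\<^sub>0\<close> for every \<open>n\<close> (\<open>sum_norm_square_le_trace\<close>).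

  So \<open>\<parallel>E\<^sub>k\<parallel>\<^sup>2\<close> is summable, and the series of the operators \<open>\<bar>E\<^sub>k\<rangle>\<langle>E\<^sub>k\<bar>\<close> converges absolutely to a
  positive operator \<open>T\<close> with trace \<open>\<Sum>k. \<parallel>E\<^sub>k\<parallel>\<^sup>2\<close> (\<open>rank_one_series\<close>). Thus the strong limit is
  \<open>R\<^sub>\<infinity> = R\<^sub>0 - T\<close>, and \<open>tr (R\<^sub>0 - R\<^sub>\<infinity>) = tr T\<close> is the claimed identity. All \<open>R\<^sub>n\<close>
  and \<open>R\<^sub>\<infinity>\<close> lie between \<open>0\<close> and \<open>R\<^sub>0\<close> and are therefore trace-class (\<open>trace_class_mono\<close>).

  The notions involved rest on three facts. A positive operator has a unique positive square root
  (\<open>positive_sqrt_ex1\<close>), obtained from a fixed-point iteration. A positive operator is its own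
  adjoint, so uniqueness of the root gives \<open>\<bar>A\<bar> = A\<close> and reduces the trace-class property to
  summability of the diagonal (\<open>abs_op_positive_op\<close>, \<open>positive_trace_class_iff\<close>). Finally, the
  diagonal sum of a positive operator does not depend on the orthonormal basis
  (\<open>positive_has_sum_diagonal_onb_independent\<close>, from \<open>parseval\<close>).
\<close>

section \<open>Complex inner product spaces\<close>

lemma cinner_scaleC_left: "cinner (c *\<^sub>C x) y = cnj c * cinner x y"
  for x :: "'a::complex_inner"
  by (metis cinner_commute cinner_scaleC_right complex_cnj_mult)

lemma norm_scaleC: "norm (c *\<^sub>C x) = cmod c * norm x"
  for x :: "'a::complex_inner"
proof -
  have "complex_of_real ((norm (c *\<^sub>C x))\<^sup>2) = (cnj c * c) * complex_of_real ((norm x)\<^sup>2)"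
    by (simp only: cinner_self[symmetric] cinner_scaleC_left cinner_scaleC_right mult_ac)
  also have "cnj c * c = complex_of_real ((cmod c)\<^sup>2)"
    by (metis complex_norm_square mult.commute of_real_power)
  finally have "(norm (c *\<^sub>C x))\<^sup>2 = (cmod c * norm x)\<^sup>2"
    by (simp only: of_real_mult[symmetric] of_real_eq_iff power_mult_distrib)
  then show ?thesis
    by simp
qed

lemma bounded_linear_scaleC: "bounded_linear (\<lambda>x::'a::complex_inner. c *\<^sub>C x)"
proof (rule bounded_linear_intro[where K = "cmod c"])
  show "c *\<^sub>C (r *\<^sub>R x) = r *\<^sub>R (c *\<^sub>C x)" for r and x :: 'a
    by (simp add: scaleR_scaleC scaleC_scaleC mult.commute)
qed (simp_all add: scaleC_add_right norm_scaleC mult.commute)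

lemma Im_cinner: "Im (cinner x y) = - inner x (\<i> *\<^sub>C y)"
  for x :: "'a::complex_inner"
  by (simp add: inner_eq_Re_cinner cinner_scaleC_right)

text \<open>Multiplying \<open>y\<close> by the conjugate phase of \<open>\<langle>x, y\<rangle>\<close> makes the complex inner product real, and
  reduces the estimate to the real Cauchy-Schwarz inequality.\<close>

lemma norm_cinner_le: "cmod (cinner x y) \<le> norm x * norm y"
  for x :: "'a::complex_inner"
proof -
  let ?c = "cnj (sgn (cinner x y))"
  have "?c * cinner x y = complex_of_real (cmod (cinner x y))"
    by (cases "cinner x y = 0")
      (simp_all add: sgn_eq complex_norm_square[symmetric] power2_eq_square field_simps flip: of_real_mult)
  then have "cmod (cinner x y) = inner x (?c *\<^sub>C y)"
    by (simp add: inner_eq_Re_cinner cinner_scaleC_right)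
  also have "\<dots> \<le> norm x * norm (?c *\<^sub>C y)"
    by (rule norm_cauchy_schwarz)
  also have "\<dots> \<le> norm x * norm y"
    by (simp add: norm_scaleC norm_sgn mult_left_mono)
  finally show ?thesis .
qed

lemma bounded_linear_cinner_right: "bounded_linear (cinner (x::'a::complex_inner))"
proof (rule bounded_linear_intro[where K = "norm x"])
  show "cinner x (r *\<^sub>R y) = r *\<^sub>R cinner x y" for r and y :: 'a
    by (simp add: scaleR_scaleC[of r y] cinner_scaleC_right scaleR_conv_of_real)
  show "norm (cinner x y) \<le> norm y * norm x" for y
    using norm_cinner_le[of x y] by (simp add: mult.commute)
qed (simp add: cinner_add_right)

lemma cmod_cinner_commute: "cmod (cinner x y) = cmod (cinner y x)"
  for x :: "'a::complex_inner"
  by (metis cinner_commute complex_mod_cnj)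


section \<open>Bounded and positive operators\<close>

lemma bounded_clinearD:
  assumes "bounded_clinear A"
  shows "bounded_linear A" and "A (c *\<^sub>C x) = c *\<^sub>C A x"
  using assms by (auto simp: bounded_clinear_def)

lemma bounded_clinear_id: "bounded_clinear (\<lambda>x. x)"
  by (simp add: bounded_clinear_def)

lemma bounded_clinear_zero: "bounded_clinear (\<lambda>x. 0)"
  by (simp add: bounded_clinear_def linear_simps[OF bounded_linear_scaleC])

lemma bounded_clinear_add:
  "bounded_clinear A \<Longrightarrow> bounded_clinear B \<Longrightarrow> bounded_clinear (\<lambda>x. A x + B x)"
  by (auto simp: bounded_clinear_def scaleC_add_right intro: bounded_linear_add)

lemma bounded_clinear_diff:
  "bounded_clinear A \<Longrightarrow> bounded_clinear B \<Longrightarrow> bounded_clinear (\<lambda>x. A x - B x)"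
  by (auto simp: bounded_clinear_def linear_simps[OF bounded_linear_scaleC]
      intro: bounded_linear_sub)

lemma bounded_clinear_scaleR: "bounded_clinear A \<Longrightarrow> bounded_clinear (\<lambda>x. r *\<^sub>R A x)"
  by (auto simp: bounded_clinear_def linear_simps[OF bounded_linear_scaleC]
      intro: bounded_linear_compose[OF bounded_linear_scaleR_right])

lemma bounded_clinear_compose:
  "bounded_clinear A \<Longrightarrow> bounded_clinear B \<Longrightarrow> bounded_clinear (\<lambda>x. A (B x))"
  by (auto simp: bounded_clinear_def intro: bounded_linear_compose)

lemma bounded_clinear_rank_one: "bounded_clinear (rank_one a b)"
  unfolding bounded_clinear_def rank_one_def
proof (intro conjI allI)
  show "bounded_linear (\<lambda>x. cinner b x *\<^sub>C a)"
  proof (rule bounded_linear_intro[where K = "norm b * norm a"])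
    show "cinner b (r *\<^sub>R x) *\<^sub>C a = r *\<^sub>R cinner b x *\<^sub>C a" for r x
      by (simp add: scaleR_scaleC cinner_scaleC_right scaleC_scaleC)
    show "norm (cinner b x *\<^sub>C a) \<le> norm x * (norm b * norm a)" for x
      using mult_right_mono[OF norm_cinner_le[of b x], of "norm a"]
      by (simp add: norm_scaleC mult_ac)
  qed (simp add: cinner_add_right scaleC_add_left)
qed (simp add: cinner_scaleC_right scaleC_scaleC)

lemma bounded_clinear_pointwise_limit:
  assumes lin: "\<And>n. bounded_clinear (A n)"
    and bound: "\<And>n x. norm (A n x) \<le> K * norm x"
    and lim: "\<And>x. (\<lambda>n. A n x) \<longlonglongrightarrow> T x"
  shows "bounded_clinear T"
  unfolding bounded_clinear_def
proof (intro conjI allI)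
  have *: "T x = y" if "(\<lambda>n. A n x) \<longlonglongrightarrow> y" for x y
    using LIMSEQ_unique[OF lim that] .
  show "bounded_linear T"
  proof (rule bounded_linear_intro[where K = K])
    show "T (x + y) = T x + T y" for x y
      by (intro *) (simp add: linear_simps[OF bounded_clinearD(1)[OF lin]] tendsto_add lim)
    show "T (r *\<^sub>R x) = r *\<^sub>R T x" for r x
      by (intro *) (simp add: linear_simps[OF bounded_clinearD(1)[OF lin]] tendsto_scaleR lim)
    show "norm (T x) \<le> norm x * K" for x
      by (rule LIMSEQ_le_const2[OF tendsto_norm[OF lim]]) (use bound in \<open>auto simp: mult.commute\<close>)
  qed
  show "T (c *\<^sub>C x) = c *\<^sub>C T x" for c x
    by (intro *)
      (simp add: bounded_clinearD(2)[OF lin] bounded_linear.tendsto[OF bounded_linear_scaleC] lim)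
qed

text \<open>The imaginary part of \<open>\<langle>x, y\<rangle>\<close> is minus the real inner product of \<open>x\<close> and \<open>i y\<close>, so for
  a complex linear operator symmetry of the real part carries over to the imaginary part.\<close>

lemma symmetric_imp_cinner_symmetric:
  assumes "bounded_clinear A" and "\<And>x y. inner (A x) y = inner x (A y)"
  shows "cinner (A x) y = cinner x (A y)"
proof (rule complex_eqI)
  show "Re (cinner (A x) y) = Re (cinner x (A y))"
    using assms(2) by (simp add: inner_eq_Re_cinner)
  show "Im (cinner (A x) y) = Im (cinner x (A y))"
    by (simp add: Im_cinner assms(2) bounded_clinearD(2)[OF assms(1), symmetric])
qed

text \<open>Positivity can be read off the real inner product: over the complex numbers
  \<open>\<langle>x, A x\<rangle> \<in> \<real>\<close> for all \<open>x\<close> forces \<open>A\<close> to be self-adjoint, by polarisation with \<open>x + y\<close> and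
  \<open>x + i y\<close>. All arguments about square roots below are carried out in this real form.\<close>

lemma positive_op_iff:
  "positive_op A \<longleftrightarrow>
     bounded_clinear A \<and> (\<forall>x y. inner (A x) y = inner x (A y)) \<and> (\<forall>x. 0 \<le> inner x (A x))"
  for A :: "'a::complex_inner \<Rightarrow> 'a"
proof
  assume pos: "positive_op A"
  then have A: "bounded_clinear A" and nonneg: "0 \<le> cinner x (A x)" for x
    by (auto simp: positive_op_def)
  have real: "inner x (\<i> *\<^sub>C A x) = 0" for x
    using nonneg[of x] Im_cinner[of x "A x"] by (simp add: less_eq_complex_def)
  have i: "inner (\<i> *\<^sub>C x) y = - inner x (\<i> *\<^sub>C y)" "\<i> *\<^sub>C \<i> *\<^sub>C x = - x" for x y :: 'a
  proof -
    show "inner (\<i> *\<^sub>C x) y = - inner x (\<i> *\<^sub>C y)"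
      by (simp add: inner_eq_Re_cinner cinner_scaleC_left cinner_scaleC_right)
    have "\<i> *\<^sub>C \<i> *\<^sub>C x = complex_of_real (- 1) *\<^sub>C x"
      by (simp add: scaleC_scaleC)
    then show "\<i> *\<^sub>C \<i> *\<^sub>C x = - x"
      by (simp only: scaleR_scaleC[symmetric] scaleR_minus1_left)
  qed
  have real': "inner (A x) (\<i> *\<^sub>C x) = 0" for x
    using i(1)[of x "A x"] real[of x] by (simp add: inner_commute)
  have "inner (A x) y = inner x (A y)" for x y
    using real'[of x] real'[of y] real[of "x + \<i> *\<^sub>C y"] real[of x] real[of y]
    by (simp add: linear_simps[OF bounded_clinearD(1)[OF A]] bounded_clinearD(2)[OF A]
        linear_simps[OF bounded_linear_scaleC] inner_add_left inner_add_right inner_diff_right i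
        inner_commute)
  moreover have "0 \<le> inner x (A x)" for x
    using nonneg[of x] by (simp add: inner_eq_Re_cinner less_eq_complex_def)
  ultimately show "bounded_clinear A \<and> (\<forall>x y. inner (A x) y = inner x (A y))
      \<and> (\<forall>x. 0 \<le> inner x (A x))"
    using A by blast
next
  assume *: "bounded_clinear A \<and> (\<forall>x y. inner (A x) y = inner x (A y)) \<and> (\<forall>x. 0 \<le> inner x (A x))"
  have "0 \<le> cinner x (A x)" for x
  proof -
    have "cinner x (A x) = cnj (cinner x (A x))"
      using * symmetric_imp_cinner_symmetric[of A x x] cinner_commute[of x "A x"] by simp
    then have "Im (cinner x (A x)) = 0"
      by (metis Reals_cnj_iff complex_is_Real_iff)
    then show ?thesis
      using * by (simp add: less_eq_complex_def inner_eq_Re_cinner)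
  qed
  then show "positive_op A"
    using * by (simp add: positive_op_def)
qed

lemma positive_opD:
  assumes "positive_op A"
  shows "bounded_clinear A" and "bounded_linear A" and "inner (A x) y = inner x (A y)"
    and "0 \<le> inner x (A x)" and "cinner (A x) y = cinner x (A y)"
    and "cinner x (A x) = complex_of_real (inner x (A x))"
proof -
  show A: "bounded_clinear A" "inner (A x) y = inner x (A y)" "0 \<le> inner x (A x)" for x y
    using assms by (auto simp: positive_op_iff)
  then show "bounded_linear A" "cinner (A x) y = cinner x (A y)"
    by (auto intro: bounded_clinearD symmetric_imp_cinner_symmetric)
  have "0 \<le> cinner x (A x)"
    using assms by (simp add: positive_op_def)
  then show "cinner x (A x) = complex_of_real (inner x (A x))"
    by (simp add: complex_eq_iff inner_eq_Re_cinner less_eq_complex_def)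
qed

text \<open>The idea is to use positivity of \<open>A\<close> at the vector \<open>x - A x / K\<close>. In operator form the bound
  reads \<open>A\<^sup>2 \<le> K A\<close>.\<close>

lemma positive_op_norm_square_le:
  assumes A: "positive_op A" and K: "0 < K" and bound: "\<And>x. norm (A x) \<le> K * norm x"
  shows "(norm (A x))\<^sup>2 \<le> K * inner x (A x)"
proof -
  have "inner (A x) (A (A x)) \<le> norm (A x) * norm (A (A x))"
    by (rule norm_cauchy_schwarz)
  also have "\<dots> \<le> norm (A x) * (K * norm (A x))"
    by (intro mult_left_mono bound) simp
  finally have "inner (A x) (A (A x)) \<le> K * (norm (A x))\<^sup>2"
    by (simp add: power2_eq_square mult_ac)
  then have *: "inner (A x) (A (A x)) / (K * K) \<le> (norm (A x))\<^sup>2 / K"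
    using K by (simp add: field_simps)
  have "0 \<le> inner (x - (1/K) *\<^sub>R A x) (A (x - (1/K) *\<^sub>R A x))"
    by (rule positive_opD(4)[OF A])
  also have "\<dots> = inner x (A x) - 2 * ((norm (A x))\<^sup>2 / K) + inner (A x) (A (A x)) / (K * K)"
    using positive_opD(3)[OF A, of x "A x"]
    by (simp add: linear_simps[OF positive_opD(2)[OF A]] inner_diff_left inner_diff_right
        power2_norm_eq_inner diff_divide_distrib)
  also have "\<dots> \<le> inner x (A x) - (norm (A x))\<^sup>2 / K"
    using * by simp
  finally show ?thesis
    using K by (simp add: field_simps)
qed

lemma bounded_linear_pos_bound:
  assumes "bounded_linear A"
  obtains K where "0 < K" and "\<And>x. norm (A x) \<le> K * norm x"
  using bounded_linear.pos_bounded[OF assms] by (metis mult.commute)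

lemma positive_op_inner_eq_0D:
  assumes A: "positive_op A" and "inner x (A x) = 0"
  shows "A x = 0"
proof -
  obtain K where "0 < K" and K: "\<And>x. norm (A x) \<le> K * norm x"
    using bounded_linear_pos_bound[OF positive_opD(2)[OF A]] by blast
  have "(norm (A x))\<^sup>2 \<le> K * inner x (A x)"
    by (rule positive_op_norm_square_le[OF A \<open>0 < K\<close> K])
  then show ?thesis
    using assms(2) by simp
qed


section \<open>Square roots of positive operators\<close>

text \<open>For \<open>0 \<le> A \<le> I\<close> write \<open>A = I - B\<close>. Then \<open>I - Y\<close> is a square root of \<open>A\<close> exactly when
  \<open>Y = (B + Y\<^sup>2) / 2\<close>, and \<open>sqrt_iter\<close> is the fixed-point iteration for this equation started at
  \<open>0\<close>. The scalar sequence \<open>sqrt_iter_bound\<close> is the same iteration for \<open>B = 1\<close>. Since \<open>\<parallel>B\<parallel> \<le> 1\<close>,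
  its values and increments dominate the norms of the iterates and of their increments. As
  the scalar sequence is increasing and bounded by \<open>1\<close>, the iterates form a Cauchy sequence in norm.\<close>

primrec sqrt_iter :: "('a::real_vector \<Rightarrow> 'a) \<Rightarrow> nat \<Rightarrow> 'a \<Rightarrow> 'a" where
  "sqrt_iter B 0 = (\<lambda>x. 0)"
| "sqrt_iter B (Suc n) = (\<lambda>x. (1/2) *\<^sub>R (B x + sqrt_iter B n (sqrt_iter B n x)))"

primrec sqrt_iter_bound :: "nat \<Rightarrow> real" where
  "sqrt_iter_bound 0 = 0"
| "sqrt_iter_bound (Suc n) = (1 + (sqrt_iter_bound n)\<^sup>2) / 2"

lemma sqrt_iter_bound_le_1: "sqrt_iter_bound n \<le> 1"
  and sqrt_iter_bound_nonneg: "0 \<le> sqrt_iter_bound n"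
proof -
  have "0 \<le> sqrt_iter_bound n \<and> sqrt_iter_bound n \<le> 1"
    by (induction n) (simp_all add: power_le_one)
  then show "sqrt_iter_bound n \<le> 1" "0 \<le> sqrt_iter_bound n"
    by auto
qed

lemma summable_sqrt_iter_bound_diff:
  "summable (\<lambda>n. sqrt_iter_bound (Suc n) - sqrt_iter_bound n)"
proof -
  have "incseq sqrt_iter_bound"
  proof (rule incseq_SucI)
    fix n
    have "0 \<le> (sqrt_iter_bound n - 1)\<^sup>2"
      by simp
    then show "sqrt_iter_bound n \<le> sqrt_iter_bound (Suc n)"
      by (simp add: power2_diff)
  qed
  then obtain l where "sqrt_iter_bound \<longlonglongrightarrow> l"
    using incseq_convergent[of sqrt_iter_bound 1] sqrt_iter_bound_le_1 by blast
  then show ?thesis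
    using telescope_sums[of sqrt_iter_bound l] unfolding summable_def by blast
qed

context
  fixes B :: "'a::complex_hilbert_space \<Rightarrow> 'a"
  assumes lin: "bounded_clinear B"
    and contr: "\<And>x. norm (B x) \<le> norm x"
    and sym: "\<And>x y. inner (B x) y = inner x (B y)"
begin

lemma bounded_clinear_sqrt_iter: "bounded_clinear (sqrt_iter B n)"
proof (induction n)
  case (Suc n)
  show ?case
    unfolding sqrt_iter.simps
    by (rule bounded_clinear_scaleR[OF bounded_clinear_add[OF lin bounded_clinear_compose[OF Suc Suc]]])
qed (simp add: bounded_clinear_zero)

lemmas sqrt_iter_linear_simps = linear_simps[OF bounded_clinearD(1)[OF bounded_clinear_sqrt_iter]]

lemma sqrt_iter_symmetric: "inner (sqrt_iter B n x) y = inner x (sqrt_iter B n y)"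
  by (induction n arbitrary: x y) (simp_all add: inner_add_left inner_add_right sym)

text \<open>Every iterate is a polynomial in \<open>B\<close>.\<close>

lemma sqrt_iter_commute:
  assumes "bounded_linear C" and "\<And>x. C (B x) = B (C x)"
  shows "C (sqrt_iter B n x) = sqrt_iter B n (C x)"
  by (induction n arbitrary: x) (simp_all add: linear_simps[OF assms(1)] assms(2))

lemma norm_sqrt_iter_le: "norm (sqrt_iter B n x) \<le> sqrt_iter_bound n * norm x"
proof (induction n arbitrary: x)
  case (Suc n)
  have "norm (sqrt_iter B n (sqrt_iter B n x)) \<le> sqrt_iter_bound n * norm (sqrt_iter B n x)"
    by (rule Suc.IH)
  also have "\<dots> \<le> sqrt_iter_bound n * (sqrt_iter_bound n * norm x)"
    by (intro mult_left_mono Suc.IH sqrt_iter_bound_nonneg)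
  finally have "norm (B x + sqrt_iter B n (sqrt_iter B n x))
      \<le> norm x + (sqrt_iter_bound n)\<^sup>2 * norm x"
    using contr[of x] norm_triangle_ineq[of "B x" "sqrt_iter B n (sqrt_iter B n x)"]
    by (simp add: power2_eq_square mult_ac)
  then show ?case
    by (simp add: distrib_right)
qed simp

lemma norm_sqrt_iter_le_norm: "norm (sqrt_iter B n x) \<le> 1 * norm x"
  using norm_sqrt_iter_le[of n x] mult_right_mono[OF sqrt_iter_bound_le_1[of n], of "norm x"] by simp

text \<open>Consecutive iterates \<open>Y\<close>, \<open>Z\<close> commute, so \<open>Z\<^sup>2 - Y\<^sup>2 = (Z - Y)(Z + Y)\<close>. The same factorisation
  holds for the scalar bounds, and the estimate passes from one step to the next.\<close>

lemma norm_sqrt_iter_diff_le: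
  "norm (sqrt_iter B (Suc n) x - sqrt_iter B n x)
     \<le> (sqrt_iter_bound (Suc n) - sqrt_iter_bound n) * norm x"
proof (induction n arbitrary: x)
  case 0
  show ?case
    using contr[of x] by simp
next
  case (Suc n)
  define Y where "Y = sqrt_iter B n"
  define Z where "Z = sqrt_iter B (Suc n)"
  define s where "s = sqrt_iter_bound n"
  define t where "t = sqrt_iter_bound (Suc n)"
  have comm: "Y (Z x) = Z (Y x)"
    unfolding Y_def Z_def
    by (rule sqrt_iter_commute[OF bounded_clinearD(1)[OF bounded_clinear_sqrt_iter]],
        rule sqrt_iter_commute[OF bounded_clinearD(1)[OF lin] refl, symmetric])
  have IH: "norm (Z y - Y y) \<le> (t - s) * norm y" for y
    using Suc.IH[of y] by (simp only: Y_def Z_def s_def t_def)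
  have "0 \<le> (t - s)"
  proof -
    have "0 \<le> (s - 1)\<^sup>2"
      by simp
    then show ?thesis
      by (simp add: s_def t_def power2_diff)
  qed
  have "sqrt_iter B (Suc (Suc n)) x = (1/2) *\<^sub>R (B x + Z (Z x))"
    unfolding Z_def by (rule fun_cong[OF sqrt_iter.simps(2)])
  moreover have "sqrt_iter B (Suc n) x = (1/2) *\<^sub>R (B x + Y (Y x))"
    unfolding Y_def by (rule fun_cong[OF sqrt_iter.simps(2)])
  ultimately have "sqrt_iter B (Suc (Suc n)) x - sqrt_iter B (Suc n) x
      = (1/2) *\<^sub>R (Z (Z x) - Y (Y x))"
    by (simp only: scaleR_add_right scaleR_diff_right) simp
  also have "Z (Z x) - Y (Y x) = Z (Z x + Y x) - Y (Z x + Y x)"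
    using comm by (simp add: Y_def Z_def sqrt_iter_linear_simps del: sqrt_iter.simps)
  also have "norm ((1/2) *\<^sub>R (Z (Z x + Y x) - Y (Z x + Y x))) \<le> (1/2) * ((t - s) * norm (Z x + Y x))"
    using IH[of "Z x + Y x"] by simp
  also have "\<dots> \<le> (1/2) * ((t - s) * (t * norm x + s * norm x))"
  proof -
    have "norm (Z x + Y x) \<le> t * norm x + s * norm x"
      unfolding Y_def Z_def s_def t_def
      by (intro norm_triangle_mono norm_sqrt_iter_le)
    then show ?thesis
      using \<open>0 \<le> t - s\<close> by (intro mult_left_mono) auto
  qed
  also have "\<dots> = ((1 + t\<^sup>2) / 2 - (1 + s\<^sup>2) / 2) * norm x"
    by (simp add: field_simps power2_eq_square)
  also have "\<dots> = (sqrt_iter_bound (Suc (Suc n)) - sqrt_iter_bound (Suc n)) * norm x"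
    unfolding sqrt_iter_bound.simps(2) s_def t_def ..
  finally show ?case .
qed

lemma sqrt_iter_limit_exists:
  obtains Y where "bounded_clinear Y" and "\<And>x y. inner (Y x) y = inner x (Y y)"
    and "\<And>x. norm (Y x) \<le> norm x" and "\<And>x. 2 *\<^sub>R Y x = B x + Y (Y x)"
    and "\<And>C x. bounded_linear C \<Longrightarrow> (\<And>x. C (B x) = B (C x)) \<Longrightarrow> C (Y x) = Y (C x)"
proof -
  have "convergent (\<lambda>n. sqrt_iter B n x)" for x
  proof -
    have "summable (\<lambda>n. sqrt_iter B (Suc n) x - sqrt_iter B n x)"
      by (rule summable_comparison_test'[OF summable_mult2[OF summable_sqrt_iter_bound_diff]])
        (rule norm_sqrt_iter_diff_le)
    then show ?thesis
      by (simp only: summable_iff_convergent sum_lessThan_telescope[of "\<lambda>n. sqrt_iter B n x"]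
          sqrt_iter.simps(1) diff_zero)
  qed
  then obtain Y where lim: "\<And>x. (\<lambda>n. sqrt_iter B n x) \<longlonglongrightarrow> Y x"
    unfolding convergent_def by metis
  have Y: "bounded_clinear Y"
    by (rule bounded_clinear_pointwise_limit[OF bounded_clinear_sqrt_iter norm_sqrt_iter_le_norm lim])
  have lim2: "(\<lambda>n. sqrt_iter B n (sqrt_iter B n x)) \<longlonglongrightarrow> Y (Y x)" for x
  proof (rule Lim_transform[OF lim])
    have "(\<lambda>n. norm (sqrt_iter B n x - Y x)) \<longlonglongrightarrow> 0"
      using lim[of x] by (simp only: LIM_zero_iff tendsto_norm_zero_iff)
    then show "(\<lambda>n. sqrt_iter B n (sqrt_iter B n x) - sqrt_iter B n (Y x)) \<longlonglongrightarrow> 0"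
    proof (rule Lim_null_comparison[rotated], intro always_eventually allI)
      show "norm (sqrt_iter B n (sqrt_iter B n x) - sqrt_iter B n (Y x))
          \<le> norm (sqrt_iter B n x - Y x)" for n
        using norm_sqrt_iter_le_norm[of n "sqrt_iter B n x - Y x"]
        by (simp add: sqrt_iter_linear_simps)
    qed
  qed
  show ?thesis
  proof (rule that[OF Y])
    show "inner (Y x) y = inner x (Y y)" for x y
      by (rule LIMSEQ_unique[OF tendsto_inner[OF lim tendsto_const]])
        (simp add: sqrt_iter_symmetric tendsto_inner lim)
    show "norm (Y x) \<le> norm x" for x
      by (rule LIMSEQ_le_const2[OF tendsto_norm[OF lim]]) (use norm_sqrt_iter_le_norm in auto)
    show "2 *\<^sub>R Y x = B x + Y (Y x)" for x
    proof -
      have "(\<lambda>n. sqrt_iter B (Suc n) x) \<longlonglongrightarrow> (1/2) *\<^sub>R (B x + Y (Y x))"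
        unfolding sqrt_iter.simps(2) by (intro tendsto_intros lim2)
      then have "Y x = (1/2) *\<^sub>R (B x + Y (Y x))"
        using LIMSEQ_unique[OF LIMSEQ_Suc[OF lim]] by blast
      from arg_cong[OF this, of "scaleR 2"] show ?thesis
        unfolding scaleR_scaleR by simp
    qed
    show "C (Y x) = Y (C x)" if C: "bounded_linear C" "\<And>x. C (B x) = B (C x)" for C x
      by (rule LIMSEQ_unique[OF bounded_linear.tendsto[OF C(1) lim]])
        (simp add: sqrt_iter_commute[OF C] lim)
  qed
qed

end

text \<open>Scaling by a norm bound \<open>K\<close> of \<open>A\<close> reduces to a contraction. That the root commutes with
  everything that commutes with \<open>A\<close> is recorded because uniqueness rests on it.\<close>

lemma positive_sqrt_exists:
  fixes A :: "'a::complex_hilbert_space \<Rightarrow> 'a"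
  assumes A: "positive_op A"
  obtains S where "positive_op S" and "\<And>x. S (S x) = A x"
    and "\<And>C x. bounded_linear C \<Longrightarrow> (\<And>x. C (A x) = A (C x)) \<Longrightarrow> C (S x) = S (C x)"
proof -
  obtain K where K: "0 < K" and bound: "\<And>x. norm (A x) \<le> K * norm x"
    using bounded_linear_pos_bound[OF positive_opD(2)[OF A]] by blast
  define B where "B x = x - (1/K) *\<^sub>R A x" for x
  have B_lin: "bounded_clinear B"
    unfolding B_def[abs_def]
    by (intro bounded_clinear_diff bounded_clinear_id bounded_clinear_scaleR positive_opD(1)[OF A])
  have B_sym: "inner (B x) y = inner x (B y)" for x y
    by (simp add: B_def inner_diff_left inner_diff_right positive_opD(3)[OF A])
  have B_contr: "norm (B x) \<le> norm x" for x
  proof -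
    have "(norm (B x))\<^sup>2 = (norm x)\<^sup>2 - 2 * (inner x (A x) / K) + (norm (A x))\<^sup>2 / (K * K)"
      by (simp add: B_def power2_norm_eq_inner inner_diff_left inner_diff_right
          inner_commute[of "A x" x] diff_divide_distrib)
    also have "(norm (A x))\<^sup>2 / (K * K) \<le> inner x (A x) / K"
      using positive_op_norm_square_le[OF A K bound, of x] K by (simp add: field_simps)
    also have "(norm x)\<^sup>2 - 2 * (inner x (A x) / K) + inner x (A x) / K \<le> (norm x)\<^sup>2"
      using K positive_opD(4)[OF A, of x] by simp
    finally show ?thesis
      by (simp add: power2_le_iff_abs_le)
  qed
  obtain Y where Y: "bounded_clinear Y" and Y_sym: "\<And>x y. inner (Y x) y = inner x (Y y)"
    and Y_contr: "\<And>x. norm (Y x) \<le> norm x" and Y_eq: "\<And>x. 2 *\<^sub>R Y x = B x + Y (Y x)"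
    and Y_comm: "\<And>C x. bounded_linear C \<Longrightarrow> (\<And>x. C (B x) = B (C x)) \<Longrightarrow> C (Y x) = Y (C x)"
    using sqrt_iter_limit_exists[OF B_lin B_contr B_sym] by blast
  note Y_simps = linear_simps[OF bounded_clinearD(1)[OF Y]]
  define S where "S x = sqrt K *\<^sub>R (x - Y x)" for x
  show ?thesis
  proof (rule that)
    show "positive_op S"
      unfolding positive_op_iff
    proof (intro conjI allI)
      show "bounded_clinear S"
        unfolding S_def[abs_def]
        by (intro bounded_clinear_diff bounded_clinear_id bounded_clinear_scaleR Y)
      show "inner (S x) y = inner x (S y)" for x y
        by (simp add: S_def inner_diff_left inner_diff_right Y_sym)
      show "0 \<le> inner x (S x)" for x
      proof -
        have "inner x (Y x) \<le> norm x * norm (Y x)"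
          by (rule norm_cauchy_schwarz)
        also have "\<dots> \<le> inner x x"
          using mult_left_mono[OF Y_contr, of "norm x" x]
          by (simp add: power2_norm_eq_inner[symmetric] power2_eq_square)
        finally show ?thesis
          using K by (simp add: S_def inner_diff_right)
      qed
    qed
    show "S (S x) = A x" for x
    proof -
      have "S (S x) = (sqrt K * sqrt K) *\<^sub>R ((x - Y x) - Y (x - Y x))"
        by (simp add: S_def Y_simps scaleR_diff_right)
      also have "(x - Y x) - Y (x - Y x) = x - (2 *\<^sub>R Y x - Y (Y x))"
        by (simp add: Y_simps scaleR_2)
      also have "2 *\<^sub>R Y x - Y (Y x) = B x"
        by (simp add: Y_eq)
      finally show ?thesis
        using K by (simp add: B_def)
    qed
    show "C (S x) = S (C x)" if C: "bounded_linear C" "\<And>x. C (A x) = A (C x)" for C x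
    proof -
      have "C (Y x) = Y (C x)"
        by (rule Y_comm[OF C(1)]) (simp add: B_def linear_simps[OF C(1)] C(2))
      then show ?thesis
        by (simp add: S_def linear_simps[OF C(1)])
    qed
  qed
qed

text \<open>For commuting roots, \<open>(S + C)(S - C) = S\<^sup>2 - C\<^sup>2 = 0\<close>. On the range of \<open>S - C\<close> the two positive
  forms add up to zero, so both \<open>S\<close> and \<open>C\<close> vanish there. Hence \<open>(S - C)\<^sup>2 = 0\<close>, and \<open>S - C\<close> is
  self-adjoint.\<close>

lemma commuting_positive_sqrt_unique:
  assumes S: "positive_op S" and C: "positive_op C"
    and eq: "\<And>x. S (S x) = C (C x)" and comm: "\<And>x. C (S x) = S (C x)"
  shows "S = C"
proof
  fix x
  note simps = linear_simps[OF positive_opD(2)[OF S]] linear_simps[OF positive_opD(2)[OF C]]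
  define y where "y = S x - C x"
  have "S y + C y = 0"
    by (simp add: y_def simps eq comm)
  then have "inner y (S y) + inner y (C y) = 0"
    by (simp flip: inner_add_right)
  then have "inner y (S y) = 0" "inner y (C y) = 0"
    using positive_opD(4)[OF S, of y] positive_opD(4)[OF C, of y] by auto
  then have "S y = 0" "C y = 0"
    using positive_op_inner_eq_0D S C by blast+
  then have "inner y (S x - C x) = 0"
    by (simp add: inner_diff_right positive_opD(3)[OF S, symmetric] positive_opD(3)[OF C, symmetric])
  then have "inner y y = 0"
    by (simp only: y_def)
  then show "S x = C x"
    by (simp add: y_def)
qed

text \<open>Any positive root \<open>C\<close> of \<open>A\<close> commutes with \<open>A = C\<^sup>2\<close>, hence with the constructed root, so
  uniqueness among commuting roots is enough. This is what gives the definite description in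
  \<open>sqrt_op\<close> its meaning.\<close>

lemma positive_sqrt_ex1:
  fixes A :: "'a::complex_hilbert_space \<Rightarrow> 'a"
  assumes A: "positive_op A"
  shows "\<exists>!S. positive_op S \<and> S \<circ> S = A"
proof -
  obtain S where S: "positive_op S" and sq: "\<And>x. S (S x) = A x"
    and comm: "\<And>C x. bounded_linear C \<Longrightarrow> (\<And>x. C (A x) = A (C x)) \<Longrightarrow> C (S x) = S (C x)"
    using positive_sqrt_exists[OF A] by blast
  show ?thesis
  proof (intro ex1I conjI)
    show "positive_op S" "S \<circ> S = A"
      using S sq by auto
    show "C = S" if C: "positive_op C \<and> C \<circ> C = A" for C
    proof -
      have sqC: "C (C x) = A x" for x
        using C by (auto dest: fun_cong)
      have "S = C"
      proof (rule commuting_positive_sqrt_unique)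
        show "C (S x) = S (C x)" for x
          using C by (intro comm) (auto intro: positive_opD simp flip: sqC)
      qed (use S C sq sqC in auto)
      then show ?thesis ..
    qed
  qed
qed

lemma positive_op_sqrt_op: "positive_op A \<Longrightarrow> positive_op (sqrt_op A)"
  and sqrt_op_sqrt_op: "positive_op A \<Longrightarrow> sqrt_op A (sqrt_op A x) = A x"
  using theI'[OF positive_sqrt_ex1, of A] by (auto simp: sqrt_op_def dest: fun_cong)

lemma sqrt_op_unique: "positive_op S \<Longrightarrow> positive_op A \<Longrightarrow> S \<circ> S = A \<Longrightarrow> sqrt_op A = S"
  unfolding sqrt_op_def by (intro the1_equality positive_sqrt_ex1) auto

lemma inner_positive_op_eq_norm_sqrt_op:
  "positive_op A \<Longrightarrow> inner x (A x) = (norm (sqrt_op A x))\<^sup>2"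
  by (simp add: power2_norm_eq_inner positive_opD(3)[OF positive_op_sqrt_op] sqrt_op_sqrt_op)

lemma adj_positive_op:
  assumes A: "positive_op A"
  shows "adj A = A"
  unfolding adj_def
proof (rule the_equality)
  show "bounded_clinear A \<and> (\<forall>x y. cinner x (A y) = cinner (A x) y)"
    using positive_opD[OF A] by simp
  show "B = A" if B: "bounded_clinear B \<and> (\<forall>x y. cinner x (A y) = cinner (B x) y)" for B
  proof
    fix x
    have "inner (B x) y = inner (A x) y" for y
      using B positive_opD(5)[OF A, of x y] by (simp add: inner_eq_Re_cinner)
    then have "inner (B x - A x) y = 0" for y
      by (simp add: inner_diff_left)
    then have "B x - A x = 0"
      by (metis inner_eq_zero_iff)
    then show "B x = A x"
      by simp
  qed
qed

lemma abs_op_positive_op: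
  assumes A: "positive_op A"
  shows "abs_op A = A"
  unfolding abs_op_def adj_positive_op[OF A]
proof (rule sqrt_op_unique[OF A])
  show "positive_op (A \<circ> A)"
    unfolding positive_op_iff o_def
  proof (intro conjI allI)
    show "bounded_clinear (\<lambda>x. A (A x))"
      by (rule bounded_clinear_compose[OF positive_opD(1)[OF A] positive_opD(1)[OF A]])
    show "inner (A (A x)) y = inner x (A (A y))" for x y
      by (simp only: positive_opD(3)[OF A])
    show "0 \<le> inner x (A (A x))" for x
      using inner_ge_zero[of "A x"] by (simp only: positive_opD(3)[OF A])
  qed
qed simp


section \<open>Orthonormal bases\<close>

text \<open>Completing the square shows at once that the Fourier coefficients give the best approximation
  and how large its error is. The case \<open>c e = \<langle>e, x\<rangle>\<close> is Bessel's inequality.\<close>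

lemma norm_diff_orthonormal_sum:
  fixes x :: "'a::complex_inner"
  assumes "finite F" and "\<And>e. e \<in> F \<Longrightarrow> norm e = 1"
    and "\<And>e f. e \<in> F \<Longrightarrow> f \<in> F \<Longrightarrow> e \<noteq> f \<Longrightarrow> cinner e f = 0"
  shows "(norm (x - (\<Sum>e\<in>F. c e *\<^sub>C e)))\<^sup>2
    = (norm x)\<^sup>2 - (\<Sum>e\<in>F. (cmod (cinner e x))\<^sup>2) + (\<Sum>e\<in>F. (cmod (c e - cinner e x))\<^sup>2)"
  using assms
proof (induction F rule: finite_induct)
  case (insert f F)
  define y where "y = x - (\<Sum>e\<in>F. c e *\<^sub>C e)"
  have "cinner f (c e *\<^sub>C e) = 0" if "e \<in> F" for e
    using insert that by (auto simp: cinner_scaleC_right)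
  then have "cinner f (\<Sum>e\<in>F. c e *\<^sub>C e) = 0"
    by (simp add: linear_sum[OF bounded_linear.linear[OF bounded_linear_cinner_right]])
  then have fy: "cinner f y = cinner f x"
    by (simp add: y_def linear_simps[OF bounded_linear_cinner_right])
  have "inner y (c f *\<^sub>C f) = Re (cnj (c f) * cinner f y)"
    using inner_commute[of y "c f *\<^sub>C f"] by (simp add: inner_eq_Re_cinner cinner_scaleC_left)
  moreover have "norm (c f *\<^sub>C f) = cmod (c f)"
    using insert.prems(1)[of f] by (simp add: norm_scaleC)
  ultimately have "(norm (y - c f *\<^sub>C f))\<^sup>2
      = (norm y)\<^sup>2 - 2 * Re (cnj (c f) * cinner f x) + (cmod (c f))\<^sup>2"
    by (simp add: power2_norm_eq_inner[where 'a = 'a] inner_diff_left inner_diff_right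
        inner_commute fy flip: power2_norm_eq_inner[of "c f *\<^sub>C f"])
  also have "\<dots> = (norm y)\<^sup>2 - (cmod (cinner f x))\<^sup>2 + (cmod (c f - cinner f x))\<^sup>2"
    by (simp add: cmod_power2) (simp add: power2_eq_square algebra_simps)
  also have "y - c f *\<^sub>C f = x - (\<Sum>e\<in>insert f F. c e *\<^sub>C e)"
    using insert.hyps by (simp add: y_def)
  finally show ?case
    using insert by (simp add: y_def)
qed simp

text \<open>Bessel's inequality bounds the partial sums above. Density of the span and the best
  approximation property bring them within any \<open>\<epsilon>\<close> of \<open>\<parallel>x\<parallel>\<^sup>2\<close>.\<close>

lemma parseval:
  assumes B: "is_onb B"
  shows "((\<lambda>e. (cmod (cinner e x))\<^sup>2) has_sum (norm x)\<^sup>2) B"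
  unfolding has_sum_def tendsto_iff
proof (intro allI impI)
  fix \<epsilon> :: real
  assume "0 < \<epsilon>"
  let ?P = "\<lambda>F. \<Sum>e\<in>F. (cmod (cinner e x))\<^sup>2"
  have on: "norm e = 1" "f \<in> B \<Longrightarrow> e \<noteq> f \<Longrightarrow> cinner e f = 0" if "e \<in> B" for e f
    using B that by (auto simp: is_onb_def)
  have bessel: "?P F \<le> (norm x)\<^sup>2" if "finite F" "F \<subseteq> B" for F
  proof -
    have "0 \<le> (norm (x - (\<Sum>e\<in>F. cinner e x *\<^sub>C e)))\<^sup>2"
      by simp
    also have "\<dots> = (norm x)\<^sup>2 - ?P F"
      using norm_diff_orthonormal_sum[of F x "\<lambda>e. cinner e x"] on that by auto
    finally show ?thesis
      by simp
  qed
  have "x \<in> closure {\<Sum>e\<in>F. c e *\<^sub>C e | F c. finite F \<and> F \<subseteq> B}"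
    using B by (simp add: is_onb_def)
  moreover have "0 < sqrt \<epsilon>"
    using \<open>0 < \<epsilon>\<close> by simp
  ultimately obtain z where "z \<in> {\<Sum>e\<in>F. c e *\<^sub>C e | F c. finite F \<and> F \<subseteq> B}"
      and "dist z x < sqrt \<epsilon>"
    unfolding closure_approachable by blast
  then obtain F c where F: "finite F" "F \<subseteq> B" and "dist (\<Sum>e\<in>F. c e *\<^sub>C e) x < sqrt \<epsilon>"
    by blast
  then have "(norm (x - (\<Sum>e\<in>F. c e *\<^sub>C e)))\<^sup>2 < (sqrt \<epsilon>)\<^sup>2"
    by (intro power_strict_mono) (auto simp: dist_norm norm_minus_commute)
  moreover have "(norm (x - (\<Sum>e\<in>F. c e *\<^sub>C e)))\<^sup>2 \<ge> (norm x)\<^sup>2 - ?P F"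
  proof -
    have "0 \<le> (\<Sum>e\<in>F. (cmod (c e - cinner e x))\<^sup>2)"
      by (simp add: sum_nonneg)
    then show ?thesis
      using norm_diff_orthonormal_sum[of F x c] on F by (auto simp: subset_iff)
  qed
  ultimately have close: "(norm x)\<^sup>2 - ?P F < \<epsilon>"
    using \<open>0 < \<epsilon>\<close> by simp
  show "\<forall>\<^sub>F G in finite_subsets_at_top B. dist (?P G) ((norm x)\<^sup>2) < \<epsilon>"
    unfolding eventually_finite_subsets_at_top
  proof (intro exI[of _ F] conjI allI impI F)
    fix G
    assume G: "finite G \<and> F \<subseteq> G \<and> G \<subseteq> B"
    then have "?P F \<le> ?P G"
      by (intro sum_mono2) auto
    then show "dist (?P G) ((norm x)\<^sup>2) < \<epsilon>"
      using close bessel[of G] G by (simp add: dist_real_def)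
  qed
qed

section \<open>Traces of positive operators\<close>

lemma has_sum_swap_nonneg:
  fixes f :: "'a \<Rightarrow> 'b \<Rightarrow> real"
  assumes rows: "\<And>x. x \<in> A \<Longrightarrow> (f x has_sum g x) B" and g: "(g has_sum S) A"
    and columns: "\<And>y. y \<in> B \<Longrightarrow> ((\<lambda>x. f x y) has_sum h y) A"
    and nonneg: "\<And>x y. x \<in> A \<Longrightarrow> y \<in> B \<Longrightarrow> 0 \<le> f x y"
  shows "(h has_sum S) B"
proof -
  have "(\<lambda>(x, y). f x y) summable_on A \<times> B"
    by (rule summable_on_SigmaI[where g = g]) (use rows g nonneg in \<open>auto simp: summable_on_def\<close>)
  then have "((\<lambda>(x, y). f x y) has_sum S) (A \<times> B)"
    by (intro has_sum_SigmaI[where g = g]) (use rows g in auto)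
  then have "((\<lambda>(y, x). f x y) has_sum S) (B \<times> A)"
    by (subst (asm) has_sum_swap) (simp add: case_prod_unfold)
  then show ?thesis
    by (rule has_sum_SigmaD) (use columns in auto)
qed

text \<open>With \<open>S\<close> the square root of \<open>A\<close>, Parseval turns the sum over either basis into the double sum
  of \<open>\<bar>\<langle>f, S e\<rangle>\<bar>\<^sup>2\<close>, which may be taken in either order because its terms are nonnegative. This
  covers summability as well as the value; the former matters because \<open>trace_class\<close> and
  \<open>op_trace\<close> may refer to different bases.\<close>

lemma positive_has_sum_diagonal_onb_independent:
  assumes A: "positive_op A" and B: "is_onb B" and C: "is_onb C"
    and S: "((\<lambda>e. inner e (A e)) has_sum S) B"
  shows "((\<lambda>f. inner f (A f)) has_sum S) C"
proof (rule has_sum_swap_nonneg)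
  let ?f = "\<lambda>e f. (cmod (cinner f (sqrt_op A e)))\<^sup>2"
  show "((\<lambda>f. ?f e f) has_sum inner e (A e)) C" for e
    using parseval[OF C, of "sqrt_op A e"] by (simp add: inner_positive_op_eq_norm_sqrt_op[OF A])
  have "?f e f = (cmod (cinner e (sqrt_op A f)))\<^sup>2" for e f
    by (metis positive_opD(5)[OF positive_op_sqrt_op[OF A]] cmod_cinner_commute)
  then show "((\<lambda>e. ?f e f) has_sum inner f (A f)) B" for f
    using parseval[OF B, of "sqrt_op A f"] by (simp add: inner_positive_op_eq_norm_sqrt_op[OF A])
  show "((\<lambda>e. inner e (A e)) has_sum S) B"
    by (rule S)
qed simp

lemma positive_trace_class_iff:
  assumes A: "positive_op A"
  shows "trace_class A \<longleftrightarrow> (\<exists>B. is_onb B \<and> (\<lambda>e. inner e (A e)) summable_on B)"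
proof -
  have "(\<lambda>e. cinner e (A e)) summable_on B \<longleftrightarrow> (\<lambda>e. inner e (A e)) summable_on B" for B
    using summable_on_of_real[of "\<lambda>e. inner e (A e)" B, where 'a = complex]
      summable_on_Re[of "\<lambda>e. cinner e (A e)" B]
    by (auto simp: positive_opD(6)[OF A])
  then show ?thesis
    using positive_opD(1)[OF A] by (simp add: trace_class_def abs_op_positive_op[OF A])
qed

lemma trace_class_mono:
  assumes A: "positive_op A" and C: "positive_op C" "trace_class C"
    and le: "\<And>x. inner x (A x) \<le> inner x (C x)"
  shows "trace_class A"
proof -
  obtain B where "is_onb B" "(\<lambda>e. inner e (C e)) summable_on B"
    using C by (auto simp: positive_trace_class_iff)
  moreover from this(2) have "(\<lambda>e. inner e (A e)) summable_on B"
    by (rule summable_on_comparison_test) (use le positive_opD(4)[OF A] in auto)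
  ultimately show ?thesis
    by (auto simp: positive_trace_class_iff[OF A])
qed

lemma op_trace_eqI:
  fixes A :: "'a::complex_hilbert_space \<Rightarrow> 'a"
  assumes A: "positive_op A" and B: "is_onb B"
    and S: "((\<lambda>e. inner e (A e)) has_sum S) B"
  shows "op_trace A = complex_of_real S"
proof -
  have "is_onb (SOME B :: 'a set. is_onb B)"
    using B by (rule someI[of is_onb])
  then have "((\<lambda>e. inner e (A e)) has_sum S) (SOME B. is_onb B)"
    by (rule positive_has_sum_diagonal_onb_independent[OF A B _ S])
  then have "((\<lambda>e. complex_of_real (inner e (A e))) has_sum complex_of_real S) (SOME B. is_onb B)"
    by (rule has_sum_of_real)
  then show ?thesis
    by (simp add: op_trace_def positive_opD(6)[OF A] infsumI)
qed


section \<open>Series of rank-one operators\<close>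

lemma inner_rank_one: "inner x (rank_one a a x) = (cmod (cinner a x))\<^sup>2"
proof -
  have "cinner x (rank_one a a x) = cinner a x * cnj (cinner a x)"
    using cinner_commute[of x a] by (simp add: rank_one_def cinner_scaleC_right)
  also have "\<dots> = complex_of_real ((cmod (cinner a x))\<^sup>2)"
    by (rule complex_norm_square[symmetric])
  finally show ?thesis
    by (simp add: inner_eq_Re_cinner)
qed

lemma positive_op_rank_one: "positive_op (rank_one a a)"
  unfolding positive_op_iff
proof (intro conjI allI)
  show "inner (rank_one a a x) y = inner x (rank_one a a y)" for x y
    using cinner_commute[of x a]
    by (simp add: rank_one_def inner_eq_Re_cinner cinner_scaleC_left cinner_scaleC_right mult.commute)
qed (simp_all add: bounded_clinear_rank_one inner_rank_one)

lemma norm_rank_one_le: "norm (rank_one a a x) \<le> (norm a)\<^sup>2 * norm x"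
  using mult_right_mono[OF norm_cinner_le[of a x], of "norm a"]
  by (simp add: rank_one_def norm_scaleC power2_eq_square mult_ac)

text \<open>One step of the recursion subtracts a rank-one operator: with \<open>S\<close> the square root of \<open>A\<close>,
  \<open>S (I - \<bar>u\<rangle>\<langle>u\<bar>) S = S\<^sup>2 - \<bar>S u\<rangle>\<langle>S u\<bar>\<close> because \<open>S\<close> is self-adjoint.\<close>

lemma sqrt_op_sandwich:
  assumes A: "positive_op A"
  shows "sqrt_op A \<circ> (id - rank_one u u) \<circ> sqrt_op A
    = (\<lambda>x. A x - rank_one (sqrt_op A u) (sqrt_op A u) x)"
proof
  fix x
  note S = positive_op_sqrt_op[OF A]
  show "(sqrt_op A \<circ> (id - rank_one u u) \<circ> sqrt_op A) x
      = A x - rank_one (sqrt_op A u) (sqrt_op A u) x"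
    by (simp add: rank_one_def sqrt_op_sqrt_op[OF A] positive_opD(5)[OF S]
        linear_simps[OF positive_opD(2)[OF S]] bounded_clinearD(2)[OF positive_opD(1)[OF S]])
qed

text \<open>The quadratic form of the difference is \<open>\<parallel>S x\<parallel>\<^sup>2 - \<bar>\<langle>u, S x\<rangle>\<bar>\<^sup>2\<close>, nonnegative by the
  Cauchy-Schwarz inequality.\<close>

lemma positive_op_sqrt_op_sandwich:
  assumes A: "positive_op A" and u: "norm u = 1"
  shows "positive_op (\<lambda>x. A x - rank_one (sqrt_op A u) (sqrt_op A u) x)"
  unfolding positive_op_iff
proof (intro conjI allI)
  let ?E = "sqrt_op A u"
  note S = positive_op_sqrt_op[OF A]
  show "bounded_clinear (\<lambda>x. A x - rank_one ?E ?E x)"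
    by (rule bounded_clinear_diff[OF positive_opD(1)[OF A] bounded_clinear_rank_one])
  show "inner (A x - rank_one ?E ?E x) y = inner x (A y - rank_one ?E ?E y)" for x y
    by (simp add: inner_diff_left inner_diff_right positive_opD(3)[OF A]
        positive_opD(3)[OF positive_op_rank_one])
  show "0 \<le> inner x (A x - rank_one ?E ?E x)" for x
  proof -
    have "cmod (cinner ?E x) \<le> norm (sqrt_op A x)"
      using norm_cinner_le[of u "sqrt_op A x"] u by (simp add: positive_opD(5)[OF S])
    then show ?thesis
      by (simp add: inner_diff_right inner_rank_one inner_positive_op_eq_norm_sqrt_op[OF A] power_mono)
  qed
qed

lemma positive_op_add:
  assumes "positive_op A" and "positive_op B"
  shows "positive_op (\<lambda>x. A x + B x)"
  using assms unfolding positive_op_iff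
  by (auto simp: inner_add_left inner_add_right intro: bounded_clinear_add)

lemma positive_op_pointwise_limit:
  assumes pos: "\<And>n. positive_op (A n)"
    and bound: "\<And>n x. norm (A n x) \<le> K * norm x"
    and lim: "\<And>x. (\<lambda>n. A n x) \<longlonglongrightarrow> T x"
  shows "positive_op T"
  unfolding positive_op_iff
proof (intro conjI allI)
  show "bounded_clinear T"
    by (rule bounded_clinear_pointwise_limit[OF positive_opD(1)[OF pos] bound lim])
  show "inner (T x) y = inner x (T y)" for x y
    by (rule LIMSEQ_unique[OF tendsto_inner[OF lim tendsto_const]])
      (simp add: positive_opD(3)[OF pos] tendsto_inner lim)
  show "0 \<le> inner x (T x)" for x
    by (rule LIMSEQ_le_const[OF tendsto_inner[OF tendsto_const lim]])
      (use positive_opD(4)[OF pos] in auto)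
qed

text \<open>Since \<open>\<parallel>E\<^sub>n\<parallel>\<^sup>2\<close> is the norm of \<open>\<bar>E\<^sub>n\<rangle>\<langle>E\<^sub>n\<bar>\<close> and also its trace, summability gives both absolute
  convergence of the operator series and, by Parseval and an exchange of nonnegative sums, the
  trace of its limit.\<close>

lemma rank_one_series:
  fixes E :: "nat \<Rightarrow> 'a::complex_hilbert_space"
  assumes E: "summable (\<lambda>n. (norm (E n))\<^sup>2)"
  obtains T where "positive_op T"
    and "\<And>x. (\<lambda>n. \<Sum>k<n. rank_one (E k) (E k) x) \<longlonglongrightarrow> T x"
    and "\<And>B. is_onb B \<Longrightarrow> ((\<lambda>e. inner e (T e)) has_sum (\<Sum>n. (norm (E n))\<^sup>2)) B"
proof -
  let ?K = "\<Sum>n. (norm (E n))\<^sup>2"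
  let ?A = "\<lambda>n x. \<Sum>k<n. rank_one (E k) (E k) x"
  have "summable (\<lambda>n. rank_one (E n) (E n) x)" for x
    by (rule summable_comparison_test'[OF summable_mult2[OF E]]) (rule norm_rank_one_le)
  then have "convergent (\<lambda>n. ?A n x)" for x
    by (simp add: summable_iff_convergent)
  then obtain T where T: "\<And>x. (\<lambda>n. ?A n x) \<longlonglongrightarrow> T x"
    unfolding convergent_def by metis
  have "positive_op (?A n)" for n
  proof (induction n)
    case 0
    show ?case
      by (simp add: positive_op_iff bounded_clinear_zero)
  next
    case (Suc n)
    show ?case
      using positive_op_add[OF Suc positive_op_rank_one] by simp
  qed
  moreover have "norm (?A n x) \<le> ?K * norm x" for n x
  proof -
    have "norm (?A n x) \<le> (\<Sum>k<n. (norm (E k))\<^sup>2 * norm x)"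
      by (intro sum_norm_le norm_rank_one_le)
    also have "\<dots> \<le> ?K * norm x"
      unfolding sum_distrib_right[symmetric]
      by (intro mult_right_mono sum_le_suminf E) auto
    finally show ?thesis .
  qed
  ultimately have "positive_op T"
    by (rule positive_op_pointwise_limit) (rule T)
  moreover have "((\<lambda>e. inner e (T e)) has_sum ?K) B" if B: "is_onb B" for B
  proof (rule has_sum_swap_nonneg)
    show "((\<lambda>e. (cmod (cinner (E k) e))\<^sup>2) has_sum (norm (E k))\<^sup>2) B" for k
      using parseval[OF B, of "E k"] by (simp add: cmod_cinner_commute)
    show "((\<lambda>k. (norm (E k))\<^sup>2) has_sum ?K) UNIV"
      by (rule sums_nonneg_imp_has_sum[OF summable_sums[OF E]]) simp
    show "((\<lambda>k. (cmod (cinner (E k) e))\<^sup>2) has_sum inner e (T e)) UNIV" for e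
    proof (rule sums_nonneg_imp_has_sum)
      have "(\<lambda>n. inner e (?A n e)) \<longlonglongrightarrow> inner e (T e)"
        by (rule tendsto_inner[OF tendsto_const T])
      then show "(\<lambda>k. (cmod (cinner (E k) e))\<^sup>2) sums inner e (T e)"
        by (simp add: sums_def inner_sum_right inner_rank_one)
    qed simp
  qed simp
  ultimately show ?thesis
    using that T by blast
qed

lemma sot_lim_eqI:
  assumes "sot_tendsto A T"
  shows "sot_lim A = T"
  unfolding sot_lim_def
proof (rule the_equality[of "sot_tendsto A", OF assms])
  show "S = T" if "sot_tendsto A S" for S
    using assms that LIMSEQ_unique unfolding sot_tendsto_def by blast
qed

text \<open>Positivity compares the diagonals entry by entry, and by Parseval the diagonal of
  \<open>\<bar>E\<^sub>k\<rangle>\<langle>E\<^sub>k\<bar>\<close> sums to \<open>\<parallel>E\<^sub>k\<parallel>\<^sup>2\<close>.\<close>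

lemma sum_norm_square_le_trace:
  fixes E :: "nat \<Rightarrow> 'a::complex_hilbert_space"
  assumes A: "positive_op (\<lambda>x. A x - (\<Sum>k<n. rank_one (E k) (E k) x))"
    and B: "is_onb B" and t: "((\<lambda>e. inner e (A e)) has_sum t) B"
  shows "(\<Sum>k<n. (norm (E k))\<^sup>2) \<le> t"
proof (rule has_sum_mono[OF _ t])
  have diag: "((\<lambda>e. (cmod (cinner (E k) e))\<^sup>2) has_sum (norm (E k))\<^sup>2) B" for k
    using parseval[OF B, of "E k"] by (simp add: cmod_cinner_commute)
  show "((\<lambda>e. \<Sum>k<n. (cmod (cinner (E k) e))\<^sup>2) has_sum (\<Sum>k<n. (norm (E k))\<^sup>2)) B"
    by (induction n) (auto intro: has_sum_add diag)
  show "(\<Sum>k<n. (cmod (cinner (E k) e))\<^sup>2) \<le> inner e (A e)" for e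
    using positive_opD(4)[OF A, of e]
    by (simp add: inner_diff_right inner_sum_right inner_rank_one)
qed

section \<open>The trace of the total decrement\<close>

theorem proposition3p3:
  fixes R0 R_inf :: "'a::complex_hilbert_space \<Rightarrow> 'a"
    and R :: "nat \<Rightarrow> 'a \<Rightarrow> 'a"
    and u E :: "nat \<Rightarrow> 'a"
  assumes "positive_op R0" and "trace_class R0"
    and "\<And>n. norm (u n) = 1"
    and "R 0 = R0"
    and "\<And>n. R (Suc n) = sqrt_op (R n) \<circ> (id - rank_one (u n) (u n)) \<circ> sqrt_op (R n)"
    and "\<And>n. E n = sqrt_op (R n) (u n)"
    and "R_inf = sot_lim R"
  shows "(\<forall>n. positive_op (R n)) \<and> positive_op R_inf \<and> sot_tendsto R R_inf
    \<and> (\<forall>n. trace_class (R n)) \<and> trace_class R_inf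
    \<and> summable (\<lambda>n. \<bar>(norm (E n))\<^sup>2\<bar>)
    \<and> op_trace (R0 - R_inf) = complex_of_real (\<Sum>n. (norm (E n))\<^sup>2)
    \<and> complex_of_real (\<Sum>n. (norm (E n))\<^sup>2) \<le> op_trace R0"
proof -
  let ?A = "\<lambda>n x. \<Sum>k<n. rank_one (E k) (E k) x"
  note R0 = assms(1,2)
  have R_eq_pos: "R n = (\<lambda>x. R0 x - ?A n x) \<and> positive_op (R n)" for n
  proof (induction n)
    case 0
    show ?case
      using assms(4) R0(1) by simp
  next
    case (Suc n)
    then have pos: "positive_op (R n)" and eq: "R n = (\<lambda>x. R0 x - ?A n x)"
      by auto
    have step: "R (Suc n) = (\<lambda>x. R n x - rank_one (E n) (E n) x)"
      using sqrt_op_sandwich[OF pos, of "u n"] by (simp only: assms(5,6))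
    have "R (Suc n) = (\<lambda>x. R0 x - ?A (Suc n) x)"
      unfolding step by (simp add: eq fun_eq_iff)
    moreover have "positive_op (R (Suc n))"
      using positive_op_sqrt_op_sandwich[OF pos assms(3)[of n]] by (simp only: step assms(6))
    ultimately show ?case
      by blast
  qed
  then have R_fun: "R n = (\<lambda>x. R0 x - ?A n x)" and R_pos: "positive_op (R n)" for n
    by blast+
  have R_eq: "R n x = R0 x - ?A n x" for n x
    by (rule fun_cong[OF R_fun])
  obtain B t where B: "is_onb B" and t: "((\<lambda>e. inner e (R0 e)) has_sum t) B"
    using R0(2) by (auto simp: positive_trace_class_iff[OF R0(1)] summable_on_def)
  have partial: "(\<Sum>k<n. (norm (E k))\<^sup>2) \<le> t" for n
    by (rule sum_norm_square_le_trace[OF _ B t]) (rule R_pos[of n, unfolded R_fun])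
  have E: "summable (\<lambda>n. (norm (E n))\<^sup>2)"
    by (rule summableI_nonneg_bounded[where x = t]) (use partial in auto)
  obtain T where T: "positive_op T" and lim: "\<And>x. (\<lambda>n. ?A n x) \<longlonglongrightarrow> T x"
    and trace: "\<And>B. is_onb B \<Longrightarrow> ((\<lambda>e. inner e (T e)) has_sum (\<Sum>n. (norm (E n))\<^sup>2)) B"
    using rank_one_series[OF E] by blast
  have R_lim: "(\<lambda>n. R n x) \<longlonglongrightarrow> R0 x - T x" for x
    unfolding R_eq by (intro tendsto_diff tendsto_const lim)
  have "bounded_clinear (\<lambda>x. R0 x - T x)"
    by (rule bounded_clinear_diff[OF positive_opD(1)[OF R0(1)] positive_opD(1)[OF T]])
  then have sot: "sot_tendsto R (\<lambda>x. R0 x - T x)"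
    using R_lim by (simp add: sot_tendsto_def)
  then have R_inf: "R_inf = (\<lambda>x. R0 x - T x)"
    using assms(7) by (simp add: sot_lim_eqI)
  \<comment> \<open>Symmetry and boundedness come from the formula \<open>R0 - T\<close>, but nonnegativity only from the limit:
    a difference of positive operators need not be positive.\<close>
  have R_inf_pos: "positive_op R_inf"
    unfolding positive_op_iff
  proof (intro conjI allI)
    show "bounded_clinear R_inf"
      unfolding R_inf by fact
    show "inner (R_inf x) y = inner x (R_inf y)" for x y
      by (simp add: R_inf inner_diff_left inner_diff_right positive_opD(3)[OF R0(1)]
          positive_opD(3)[OF T])
    show "0 \<le> inner x (R_inf x)" for x
      unfolding R_inf
      by (rule LIMSEQ_le_const[OF tendsto_inner[OF tendsto_const R_lim]])
        (use positive_opD(4)[OF R_pos] in auto)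
  qed
  have "trace_class (R n)" for n
  proof (rule trace_class_mono[OF R_pos R0])
    show "inner x (R n x) \<le> inner x (R0 x)" for x
      by (simp add: R_eq inner_diff_right inner_sum_right inner_rank_one sum_nonneg)
  qed
  moreover have "trace_class R_inf"
  proof (rule trace_class_mono[OF R_inf_pos R0])
    show "inner x (R_inf x) \<le> inner x (R0 x)" for x
      using positive_opD(4)[OF T, of x] by (simp add: R_inf inner_diff_right)
  qed
  moreover have "op_trace (R0 - R_inf) = complex_of_real (\<Sum>n. (norm (E n))\<^sup>2)"
  proof -
    have "R0 - R_inf = T"
      by (simp add: R_inf fun_eq_iff)
    then show ?thesis
      using op_trace_eqI[OF T B trace[OF B]] by simp
  qed
  moreover have "complex_of_real (\<Sum>n. (norm (E n))\<^sup>2) \<le> op_trace R0"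
    unfolding op_trace_eqI[OF R0(1) B t]
    using suminf_le_const[OF E partial] by (simp add: less_eq_complex_def)
  ultimately show ?thesis
    using R_pos R_inf_pos sot E by (simp add: R_inf)
qed

end
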